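(* Let $n\in\{1,2,\ldots\}$ and $\beta\in(0,1)$. Define, for $x\in\{0,\ldots,n\}$, $$K(x):=\bigcup_{l\in\{0,\ldots,x\},\ m\in\{x-l,\ldots,n-l\}}\left(\tfrac mn K_{\mathrm{CP},m}(x-l)+\tfrac ln\right),$$ where $K_{\mathrm{CP},m}$ is the Clopper-Pearson $\beta$-confidence upray. Then: (1) $K$ is the optimal isotone $\beta$-confidence upray for the average success probability problem; (2) $K$ is admissible in the set of all $\beta$-confidence uprays for the average success probability problem; (3) $K$ is strictly isotone; (4) $K$ has effective level $\inf_{p\in[0,1]^n}\mathrm{BC}_p(\{x : \overline p\in K(x)\})=\beta$; (5) $K(0)=[0,1]$, $K(1)=\left(\frac{1-\beta}{n},1\right]$, and, if $\beta\ge\beta_n$, then $K(x)=\left(g_n(x),1\right]$ for every $x\in\{2,\ldots,n\}$.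
   Context: $\mathrm{B}_{m,p}$ is the binomial law with parameters $m\in\{0,1,2,\ldots\}$ and $p\in[0,1]$. For $p=(p_1,\ldots,p_n)\in[0,1]^n$, $\mathrm{BC}_p$ is the Bernoulli convolution (Poisson-binomial law), i.e. the law of the sum of $n$ independent Bernoulli variables with success probabilities $p_1,\ldots,p_n$, and $\overline p:=\frac1n\sum_{j=1}^n p_j$. For $A\subseteq[0,1]$ and reals $s,t$, $sA+t:=\{sa+t : a\in A\}$. For $m\ge1$ and $x\in\{1,\ldots,m\}$, $g_m(x)=g_{m,\beta}(x)$ denotes the unique $p\in[0,1]$ with $\mathrm{B}_{m,p}(\{x,\ldots,m\})=1-\beta$. For $m\ge0$ the Clopper-Pearson upray $K_{\mathrm{CP},m}\colon\{0,\ldots,m\}\to2^{[0,1]}$ is $K_{\mathrm{CP},m}(0):=[0,1]$ and $K_{\mathrm{CP},m}(x):=(g_m(x),1]$ for $x\in\{1,\ldots,m\}$. Put $\beta_n:=\mathrm{B}_{n,1/n}(\{0,1\})$. A $\beta$-confidence region for the average success probability problem is a function $K\colon\{0,\ldots,n\}\to2^{[0,1]}$ with $\mathrm{BC}_p(\{x : \overline p\in K(x)\})\ge\beta$ for all $p\in[0,1]^n$. A set $J\subseteq[0,1]$ is an upray in $[0,1]$ if $x\in J$, $y\in[0,1]$, $x\le y$ imply $y\in J$ (the paper describes these as the sets $[a,1]$ or $(a,1]$ with $a\in[0,1]$). A function $K\colon\{0,\ldots,n\}\to2^{[0,1]}$ is an upray if each value $K(x)$ is an upray in $[0,1]$; a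 $\beta$-confidence upray is an upray that is a $\beta$-confidence region. An upray $K$ is isotone if $x<y$ implies $K(x)\supseteq K(y)$, and strictly isotone if $x<y$ implies $K(x)\supsetneq K(y)$. An isotone $\beta$-confidence upray $K$ is (Buehler-)optimal if every other isotone $\beta$-confidence upray $K^*$ satisfies $K(x)\subseteq K^*(x)$ for every $x\in\{0,\ldots,n\}$. A (not necessarily isotone) $\beta$-confidence upray $K$ is admissible in the set of all $\beta$-confidence uprays if every $\beta$-confidence upray $K^*$ with $K^*(x)\subseteq K(x)$ for each $x\in\{0,\ldots,n\}$ satisfies $K^*=K$. *)

theory Defs
  imports "HOL-Probability.Probability"
begin

definition unit_cube :: "nat \<Rightarrow> (nat \<Rightarrow> real) set" where
  "unit_cube n = (\<Pi>\<^sub>E i\<in>{1..n}. {0..1})"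

definition avg :: "nat \<Rightarrow> (nat \<Rightarrow> real) \<Rightarrow> real" where
  "avg n p = (1 / real n) * (\<Sum>j\<in>{1..n}. p j)"

text \<open>The Bernoulli convolution (Poisson-binomial law): the law of the number of successes
  under the product of the Bernoulli laws with success probabilities \<open>p 1, \<dots>, p n\<close>.\<close>

definition bernoulli_conv :: "nat \<Rightarrow> (nat \<Rightarrow> real) \<Rightarrow> nat pmf" where
  "bernoulli_conv n p =
     map_pmf (\<lambda>\<omega>. \<Sum>j\<in>{1..n}. of_bool (\<omega> j)) (Pi_pmf {1..n} False (\<lambda>j. bernoulli_pmf (p j)))"

definition cp_bound :: "real \<Rightarrow> nat \<Rightarrow> nat \<Rightarrow> real" where
  "cp_bound \<beta> m x =
     (THE p. p \<in> {0..1} \<and> measure_pmf.prob (binomial_pmf m p) {x..m} = 1 - \<beta>)"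

definition cp_upray :: "real \<Rightarrow> nat \<Rightarrow> nat \<Rightarrow> real set" where
  "cp_upray \<beta> m x = (if x = 0 then {0..1} else {cp_bound \<beta> m x<..1})"

text \<open>Functions on \<open>{0..n}\<close> with values in the subsets of \<open>[0,1]\<close> are represented by total
  functions on \<open>nat\<close>; all notions below only depend on the values on \<open>{0..n}\<close>.\<close>

definition coverage :: "nat \<Rightarrow> (nat \<Rightarrow> real set) \<Rightarrow> (nat \<Rightarrow> real) \<Rightarrow> real" where
  "coverage n K p = measure_pmf.prob (bernoulli_conv n p) {x \<in> {0..n}. avg n p \<in> K x}"

definition confidence_region :: "real \<Rightarrow> nat \<Rightarrow> (nat \<Rightarrow> real set) \<Rightarrow> bool" where
  "confidence_region \<beta> n K \<longleftrightarrow>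
     (\<forall>x\<in>{0..n}. K x \<subseteq> {0..1}) \<and> (\<forall>p\<in>unit_cube n. coverage n K p \<ge> \<beta>)"

definition effective_level :: "nat \<Rightarrow> (nat \<Rightarrow> real set) \<Rightarrow> real" where
  "effective_level n K = (INF p\<in>unit_cube n. coverage n K p)"

text \<open>The empty set is an upray: it is \<open>(1,1]\<close>.\<close>

definition upray_set :: "real set \<Rightarrow> bool" where
  "upray_set J \<longleftrightarrow> J \<subseteq> {0..1} \<and> (\<forall>x\<in>J. \<forall>y\<in>{0..1}. x \<le> y \<longrightarrow> y \<in> J)"

definition upray :: "nat \<Rightarrow> (nat \<Rightarrow> real set) \<Rightarrow> bool" where
  "upray n K \<longleftrightarrow> (\<forall>x\<in>{0..n}. upray_set (K x))"

definition confidence_upray :: "real \<Rightarrow> nat \<Rightarrow> (nat \<Rightarrow> real set) \<Rightarrow> bool" where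
  "confidence_upray \<beta> n K \<longleftrightarrow> upray n K \<and> confidence_region \<beta> n K"

definition isotone :: "nat \<Rightarrow> (nat \<Rightarrow> real set) \<Rightarrow> bool" where
  "isotone n K \<longleftrightarrow> (\<forall>x\<in>{0..n}. \<forall>y\<in>{0..n}. x < y \<longrightarrow> K x \<supseteq> K y)"

definition strictly_isotone :: "nat \<Rightarrow> (nat \<Rightarrow> real set) \<Rightarrow> bool" where
  "strictly_isotone n K \<longleftrightarrow> (\<forall>x\<in>{0..n}. \<forall>y\<in>{0..n}. x < y \<longrightarrow> K x \<supset> K y)"

definition optimal_isotone :: "real \<Rightarrow> nat \<Rightarrow> (nat \<Rightarrow> real set) \<Rightarrow> bool" where
  "optimal_isotone \<beta> n K \<longleftrightarrow> confidence_upray \<beta> n K \<and> isotone n K \<and>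
     (\<forall>K'. confidence_upray \<beta> n K' \<and> isotone n K' \<longrightarrow> (\<forall>x\<in>{0..n}. K x \<subseteq> K' x))"

definition admissible :: "real \<Rightarrow> nat \<Rightarrow> (nat \<Rightarrow> real set) \<Rightarrow> bool" where
  "admissible \<beta> n K \<longleftrightarrow> confidence_upray \<beta> n K \<and>
     (\<forall>K'. confidence_upray \<beta> n K' \<and> (\<forall>x\<in>{0..n}. K' x \<subseteq> K x) \<longrightarrow> (\<forall>x\<in>{0..n}. K' x = K x))"

end

theory Submission
  imports Defs
begin

text \<open>For \<open>1 \<le> x \<le> n\<close> the set \<open>K x\<close> is a half-open interval \<open>(c x, 1]\<close>, and everything is read off from its lower
end \<open>c x\<close>: it is the smallest value of \<open>(m * g + l) / n\<close>, where \<open>l < x\<close> trials succeed surely, \<open>m\<close> trials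
share the success probability \<open>g\<close>, the other trials fail surely, and \<open>g\<close> is chosen so that at least
\<open>x\<close> successes occur with probability exactly \<open>1 - \<beta>\<close>. So \<open>c x\<close> is the smallest average success
probability at which a law with these three values puts mass \<open>1 - \<beta>\<close> on \<open>{x..n}\<close>.

That \<open>K\<close> has level \<open>\<beta>\<close> therefore amounts to Hoeffding's theorem: for a given average, the tail probability
is largest for success probabilities that take at most one value other than 0 and 1
(\<open>hoeffding_extremal\<close>). If the average is at most \<open>c x\<close>, at least \<open>x\<close> successes then have probability at most
\<open>1 - \<beta>\<close>, and since the \<open>c x\<close> increase with \<open>x\<close>, the numbers of successes that cover a given average form
an initial segment of \<open>{0..n}\<close>.

Nothing smaller has level \<open>\<beta>\<close>: by its definition as a union, \<open>K x\<close> consists of averages \<open>t\<close> of three-valued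
vectors for which at least \<open>x\<close> successes occur with probability greater than \<open>1 - \<beta>\<close>, so a confidence region
must contain \<open>t\<close> in one of its values at some \<open>y \<ge> x\<close> (\<open>confidence_region_meets\<close>). For isotone uprays this
gives optimality. For admissibility among all uprays, \<open>t\<close> is first lowered below the point where \<open>K (x + 1)\<close>
begins, which leaves only \<open>y = x\<close>.

For large \<open>\<beta>\<close> the minimum defining \<open>c x\<close> is attained by the binomial law with \<open>n\<close> trials. This uses
Hoeffding's sharper statement that, when the expected number of successes is at most \<open>x - 1\<close>, equal success
probabilities maximise the tail at \<open>x\<close> (\<open>tail_le_binomial_tail\<close>). It applies because the tail of the binomial
law with integer mean \<open>k\<close> just above its mean is smallest for \<open>k = 1\<close> (\<open>binomial_tail_above_mean\<close>), which turns
the assumption on \<open>\<beta>\<close> into the upper bound \<open>(x - 1) / n\<close> on the Clopper-Pearson bound \<open>g_n(x)\<close>, for all \<open>x \<ge> 2\<close>.\<close>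

section \<open>Tails of Poisson-binomial laws\<close>

definition poisson_binomial :: "'a set \<Rightarrow> ('a \<Rightarrow> real) \<Rightarrow> nat pmf" where
  "poisson_binomial A p =
     map_pmf (\<lambda>\<omega>. \<Sum>j\<in>A. of_bool (\<omega> j)) (Pi_pmf A False (\<lambda>j. bernoulli_pmf (p j)))"

definition tail :: "'a set \<Rightarrow> ('a \<Rightarrow> real) \<Rightarrow> nat \<Rightarrow> real" where
  "tail A p x = measure_pmf.prob (poisson_binomial A p) {x..}"

definition binomial_tail :: "nat \<Rightarrow> real \<Rightarrow> nat \<Rightarrow> real" where
  "binomial_tail m a x = measure_pmf.prob (binomial_pmf m a) {x..}"

lemma tail_0 [simp]: "tail A p 0 = 1"
proof -
  have "{0::nat..} = UNIV" by auto
  then show ?thesis by (simp add: tail_def)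
qed

lemma tail_empty: "tail {} p x = of_bool (x = 0)"
  by (simp add: tail_def poisson_binomial_def of_bool_def indicator_def)

lemma tail_cong:
  assumes "\<And>i. i \<in> A \<Longrightarrow> p i = q i"
  shows "tail A p x = tail A q x"
  unfolding tail_def poisson_binomial_def
  by (intro arg_cong2[where f = measure_pmf.prob] refl map_pmf_cong Pi_pmf_cong) (simp_all add: assms)

lemma poisson_binomial_insert:
  assumes "finite A" and "i \<notin> A"
  shows "poisson_binomial (insert i A) p =
    bernoulli_pmf (p i) \<bind> (\<lambda>b. map_pmf (\<lambda>k. of_bool b + k) (poisson_binomial A p))"
proof -
  have eq: "(\<Sum>j\<in>A. of_bool (if j = i then b else f j)) = (\<Sum>j\<in>A. of_bool (f j) :: nat)" for b f
    using assms by (intro sum.cong) auto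
  show ?thesis
    using assms unfolding poisson_binomial_def
    by (simp add: Pi_pmf_insert pair_pmf_def map_bind_pmf map_pmf_def bind_assoc_pmf bind_return_pmf eq
        cong: bind_pmf_cong del: sum_of_bool_eq)
qed

text \<open>Conditioning on one trial. For \<open>x = 0\<close> the truncated \<open>x - 1 = 0\<close> is harmless, as both tails are then 1.\<close>

lemma tail_insert:
  assumes "finite A" and "i \<notin> A" and "p i \<in> {0..1}"
  shows "tail (insert i A) p x = p i * tail A p (x - 1) + (1 - p i) * tail A p x"
proof -
  have v: "(+) (Suc 0) -` {x..} = {x - Suc 0..}" "(+) 0 -` {x..} = {x..}"
    by auto
  have "tail (insert i A) p x = measure_pmf.expectation (bernoulli_pmf (p i))
      (\<lambda>b. measure_pmf.prob (map_pmf (\<lambda>k. of_bool b + k) (poisson_binomial A p)) {x..})"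
    unfolding tail_def poisson_binomial_insert[OF assms(1,2)]
    unfolding measure_pmf_bind
    by (rule measure_pmf.measure_bind[where N = "count_space UNIV"]) (auto intro: measure_pmf_in_subprob_algebra)
  also have "\<dots> = p i * tail A p (x - 1) + (1 - p i) * tail A p x"
    using assms(3) by (subst integral_bernoulli_pmf) (auto simp: v tail_def algebra_simps)
  finally show ?thesis .
qed

text \<open>The recursion over the trials exhibits the tail as a polynomial in the success probabilities.\<close>

lemma continuous_tail:
  assumes "finite A"
  shows "continuous_on {p. \<forall>i\<in>A. p i \<in> {0..1}} (\<lambda>p. tail A p x)"
  using assms
proof (induction A arbitrary: x)
  case empty
  then show ?case by (simp add: tail_empty)
next
  case (insert i A)
  have c: "continuous_on {p. \<forall>i\<in>insert i A. p i \<in> {0..1}} (\<lambda>p. tail A p y)" for y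
    by (rule continuous_on_subset[OF insert.IH]) auto
  have d: "continuous_on {p. \<forall>i\<in>insert i A. p i \<in> {0..1}} (\<lambda>p :: 'a \<Rightarrow> real. p i)"
    by (rule continuous_on_subset[OF continuous_on_product_coordinates]) auto
  have "continuous_on {p. \<forall>i\<in>insert i A. p i \<in> {0..1}}
      (\<lambda>p. p i * tail A p (x - 1) + (1 - p i) * tail A p x)"
    by (intro continuous_intros c d)
  then show ?case
    by (rule continuous_on_eq) (use insert in \<open>auto simp: tail_insert\<close>)
qed

lemma tail_binomial:
  assumes "finite A" and "a \<in> {0..1}"
  shows "tail A (\<lambda>_. a) x = binomial_tail (card A) a x"
proof -
  have "binomial_pmf (card A) a = map_pmf (\<lambda>f. card {i\<in>A. f i}) (Pi_pmf A False (\<lambda>_. bernoulli_pmf a))"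
    using assms by (intro binomial_pmf_altdef') auto
  also have "(\<lambda>f. card {i\<in>A. f i}) = (\<lambda>f. \<Sum>j\<in>A. of_bool (f j) :: nat)"
    using assms by (auto simp: fun_eq_iff sum.If_cases of_bool_def Int_def)
  finally show ?thesis
    by (simp add: tail_def binomial_tail_def poisson_binomial_def)
qed

lemma tail_ones_zeros:
  assumes "finite L" "finite M" "finite Z" "L \<inter> M = {}" "L \<inter> Z = {}" "M \<inter> Z = {}"
    and "\<And>i. i \<in> L \<Longrightarrow> p i = 1" "\<And>i. i \<in> Z \<Longrightarrow> p i = 0" "\<And>i. i \<in> M \<Longrightarrow> p i = a" "a \<in> {0..1}"
  shows "tail (L \<union> M \<union> Z) p x = binomial_tail (card M) a (x - card L)"
proof -
  have "tail (Z \<union> M) p x = tail M p x" for x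
    using assms(3,6,8)
  proof (induction Z)
    case (insert i Z)
    have "tail (insert i (Z \<union> M)) p x = tail (Z \<union> M) p x"
      using insert assms(2) by (subst tail_insert) auto
    then show ?case using insert by auto
  qed auto
  moreover have "tail (L \<union> (Z \<union> M)) p x = tail (Z \<union> M) p (x - card L)"
    using assms(1,4,5,7)
  proof (induction L arbitrary: x)
    case (insert i L)
    have "tail (insert i (L \<union> (Z \<union> M))) p x = tail (L \<union> (Z \<union> M)) p (x - 1)"
      using insert assms(2,3) by (subst tail_insert) auto
    then show ?case using insert by auto
  qed auto
  moreover have "tail M p (x - card L) = tail M (\<lambda>_. a) (x - card L)"
    using assms(9) by (rule tail_cong)
  moreover have "L \<union> M \<union> Z = L \<union> (Z \<union> M)" by auto
  ultimately show ?thesis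
    using tail_binomial[OF assms(2,10)] by simp
qed


section \<open>Redistributing probability between two trials\<close>

text \<open>The coefficient of \<open>p i * p j\<close> in the tail, which is affine in each success probability.\<close>

definition interaction :: "'a set \<Rightarrow> ('a \<Rightarrow> real) \<Rightarrow> nat \<Rightarrow> 'a \<Rightarrow> 'a \<Rightarrow> real" where
  "interaction A p x i j =
     tail (A - {i, j}) p (x - 2) - 2 * tail (A - {i, j}) p (x - 1) + tail (A - {i, j}) p x"

lemma tail_pair:
  assumes "finite A" "i \<in> A" "j \<in> A" "i \<noteq> j" "p i \<in> {0..1}" "p j \<in> {0..1}"
  shows "tail A p x = tail (A - {i, j}) p x
    + (p i + p j) * (tail (A - {i, j}) p (x - 1) - tail (A - {i, j}) p x)
    + p i * p j * interaction A p x i j"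
proof -
  have A: "insert j (A - {i, j}) = A - {i}" "insert i (A - {i}) = A" using assms by auto
  have j: "tail (A - {i}) p y
      = p j * tail (A - {i, j}) p (y - 1) + (1 - p j) * tail (A - {i, j}) p y" for y
    using tail_insert[of "A - {i, j}" j p y] assms A by simp
  have "tail A p x = p i * tail (A - {i}) p (x - 1) + (1 - p i) * tail (A - {i}) p x"
    using tail_insert[of "A - {i}" i p x] assms A by simp
  moreover have "x - 1 - 1 = x - 2" by simp
  ultimately show ?thesis
    unfolding j interaction_def by (simp add: algebra_simps)
qed

text \<open>With \<open>p i + p j\<close> held fixed the tail depends on these two probabilities only through their product, so
the sign of the interaction decides whether it pays to move them together or apart.\<close>

lemma tail_redistribute:
  assumes "finite A" "i \<in> A" "j \<in> A" "i \<noteq> j" "\<And>k. k \<in> A \<Longrightarrow> p k \<in> {0..1}"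
    and "u \<in> {0..1}" "v \<in> {0..1}" "u + v = p i + p j"
  shows "tail A (p(i := u, j := v)) x = tail A p x + (u * v - p i * p j) * interaction A p x i j"
proof -
  let ?q = "p(i := u, j := v)"
  have c: "tail (A - {i, j}) ?q y = tail (A - {i, j}) p y" for y
    by (rule tail_cong) auto
  then have "interaction A ?q x i j = interaction A p x i j"
    by (simp add: interaction_def)
  then show ?thesis
    using tail_pair[of A i j ?q x] tail_pair[of A i j p x] assms
    by (simp add: c) (simp add: algebra_simps)
qed

text \<open>Coordinates outside \<open>A\<close> are pinned to 0, so that the set is compact in the full function space.\<close>

lemma compact_fixed_sum:
  assumes "finite A"
  shows "compact {q :: 'a \<Rightarrow> real. (\<forall>i. q i \<in> (if i \<in> A then {0..1} else {0})) \<and> sum q A = s}"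
proof -
  let ?S = "\<lambda>i. if i \<in> A then {0..1} else {0 :: real}"
  have "compactin (product_topology (\<lambda>i. euclidean) UNIV) (PiE UNIV ?S)"
    unfolding compactin_PiE by (auto simp: compactin_euclidean_iff)
  then have "compact (PiE UNIV ?S)"
    by (simp add: euclidean_product_topology)
  moreover have "closed {q :: 'a \<Rightarrow> real. sum q A = s}"
    by (intro closed_Collect_eq continuous_on_sum continuous_on_product_coordinates continuous_on_const)
  ultimately have "compact (PiE UNIV ?S \<inter> {q. sum q A = s})"
    by (rule compact_Int_closed)
  moreover have "PiE UNIV ?S \<inter> {q. sum q A = s}
      = {q. (\<forall>i. q i \<in> ?S i) \<and> sum q A = s}"
    by (auto simp: PiE_def Pi_def)
  ultimately show ?thesis by simp
qed

text \<open>Among the maximisers of the tail with the given sum, choose one with minimal sum of squares. If two unequal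
coordinates had interaction at least 0, replacing both by their mean would increase their product and so keep
the vector a maximiser while reducing the sum of squares; hence the interaction is negative. But then, if both
coordinates were in \<open>(0,1)\<close>, moving them apart would decrease their product and increase the maximal tail.\<close>

lemma exists_extremal:
  fixes p :: "'a \<Rightarrow> real"
  assumes fin: "finite A" and p: "\<And>i. i \<in> A \<Longrightarrow> p i \<in> {0..1}"
  obtains q where "\<And>i. i \<in> A \<Longrightarrow> q i \<in> {0..1}" "sum q A = sum p A" "tail A p x \<le> tail A q x"
    "\<And>i j. i \<in> A \<Longrightarrow> j \<in> A \<Longrightarrow> q i \<noteq> q j \<Longrightarrow> interaction A q x i j < 0"
    "\<And>i j. i \<in> A \<Longrightarrow> j \<in> A \<Longrightarrow> q i \<noteq> q j \<Longrightarrow> q i \<in> {0, 1} \<or> q j \<in> {0, 1}"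
proof -
  define D :: "('a \<Rightarrow> real) set" where
    "D = {q. (\<forall>i. q i \<in> (if i \<in> A then {0..1} else {0})) \<and> sum q A = sum p A}"
  have D01: "q i \<in> {0..1}" if "q \<in> D" "i \<in> A" for q i
    using that by (auto simp: D_def split: if_splits)
  have compD: "compact D"
    unfolding D_def by (rule compact_fixed_sum[OF fin])
  have contD: "continuous_on D (\<lambda>q. tail A q x)"
    by (rule continuous_on_subset[OF continuous_tail[OF fin]]) (use D01 in auto)
  define p0 where "p0 = (\<lambda>i. if i \<in> A then p i else 0)"
  have p0: "p0 \<in> D" using p by (auto simp: D_def p0_def)
  obtain r where r: "r \<in> D" "\<And>q. q \<in> D \<Longrightarrow> tail A q x \<le> tail A r x"
    using continuous_attains_sup[OF compD _ contD] p0 by blast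
  define E where "E = {q \<in> D. tail A q x = tail A r x}"
  have "closedin (top_of_set D) (D \<inter> (\<lambda>q. tail A q x) -` {tail A r x})"
    by (rule continuous_closedin_preimage[OF contD]) auto
  moreover have "D \<inter> (\<lambda>q. tail A q x) -` {tail A r x} = E"
    by (auto simp: E_def)
  ultimately have "compact E"
    using closedin_compact[OF compD] by metis
  moreover have "continuous_on E (\<lambda>q. \<Sum>i\<in>A. (q i)\<^sup>2)"
    by (intro continuous_on_sum continuous_on_power continuous_on_subset[OF continuous_on_product_coordinates]) auto
  moreover have "E \<noteq> {}" using r by (auto simp: E_def)
  ultimately obtain q where q: "q \<in> E" "\<And>q'. q' \<in> E \<Longrightarrow> (\<Sum>i\<in>A. (q i)\<^sup>2) \<le> (\<Sum>i\<in>A. (q' i)\<^sup>2)"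
    using continuous_attains_inf by meson
  have qD: "q \<in> D" and qmax: "\<And>q'. q' \<in> D \<Longrightarrow> tail A q' x \<le> tail A q x"
    using q(1) r by (auto simp: E_def)
  have q01: "\<And>i. i \<in> A \<Longrightarrow> q i \<in> {0..1}" using D01 qD by blast
  have split: "sum f A = f i + f j + sum f (A - {i, j})" if "i \<in> A" "j \<in> A" "i \<noteq> j" for f :: "'a \<Rightarrow> real" and i j
  proof -
    have "A - {i} - {j} = A - {i, j}" by auto
    then show ?thesis using that fin by (simp add: sum.remove[of A i] sum.remove[of "A - {i}" j])
  qed
  have upd: "q(i := u, j := v) \<in> D"
    if "i \<in> A" "j \<in> A" "i \<noteq> j" "u \<in> {0..1}" "v \<in> {0..1}" "u + v = q i + q j" for i j u v
  proof -
    have "sum (q(i := u, j := v)) (A - {i, j}) = sum q (A - {i, j})"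
      by (rule sum.cong) auto
    then have "sum (q(i := u, j := v)) A = sum q A"
      using that by (simp add: split[OF that(1-3)])
    moreover have "(q(i := u, j := v)) k \<in> (if k \<in> A then {0..1} else {0})" for k
    proof -
      have "q k \<in> (if k \<in> A then {0..1} else {0})" using qD unfolding D_def by blast
      then show ?thesis using that by (cases "k \<in> A") auto
    qed
    ultimately show ?thesis using qD by (simp add: D_def)
  qed
  have neg: "interaction A q x i j < 0" if "i \<in> A" "j \<in> A" "q i \<noteq> q j" for i j
  proof (rule ccontr)
    assume nonneg: "\<not> interaction A q x i j < 0"
    define u where "u = (q i + q j) / 2"
    let ?q = "q(i := u, j := u)"
    have ij: "i \<noteq> j" using that by auto
    have u: "u \<in> {0..1}" "u + u = q i + q j"
      using q01[OF that(1)] q01[OF that(2)] by (auto simp: u_def)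
    have "0 < (q i - q j)\<^sup>2" using that by simp
    then have d: "u * u - q i * q j > 0" "2 * u\<^sup>2 < (q i)\<^sup>2 + (q j)\<^sup>2"
      by (simp_all add: u_def power2_eq_square field_simps)
    have D: "?q \<in> D" using upd[of i j u u] u that ij by blast
    have "tail A ?q x = tail A q x + (u * u - q i * q j) * interaction A q x i j"
      using tail_redistribute[of A i j q u u x] fin that ij q01 u by blast
    moreover have "(u * u - q i * q j) * interaction A q x i j \<ge> 0"
      using d nonneg by simp
    ultimately have "?q \<in> E" using D qmax[OF D] q(1) by (simp add: E_def)
    moreover have "(\<Sum>k\<in>A - {i, j}. (?q k)\<^sup>2) = (\<Sum>k\<in>A - {i, j}. (q k)\<^sup>2)"
      by (rule sum.cong) auto
    then have "(\<Sum>k\<in>A. (?q k)\<^sup>2) < (\<Sum>k\<in>A. (q k)\<^sup>2)"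
      using d(2) ij by (simp add: split[OF that(1,2) ij])
    ultimately show False using q(2)[of ?q] by simp
  qed
  have bdry: "q i \<in> {0, 1} \<or> q j \<in> {0, 1}" if "i \<in> A" "j \<in> A" "q i \<noteq> q j" for i j
  proof (rule ccontr)
    assume "\<not> ?thesis"
    then have int: "0 < q i" "q i < 1" "0 < q j" "q j < 1"
      using q01[OF that(1)] q01[OF that(2)] by auto
    have ij: "i \<noteq> j" using that by auto
    \<comment> \<open>A step that keeps both coordinates in the unit interval in either direction.\<close>
    define e where "e = min (min (q i) (1 - q i)) (min (q j) (1 - q j))"
    define t where "t = (if q i > q j then e else - e)"
    have e: "0 < e" using int by (simp add: e_def)
    have t: "q i + t \<in> {0..1}" "q j - t \<in> {0..1}"
      using int by (auto simp: t_def e_def)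
    have "t * (q j - q i) \<le> 0" "t\<^sup>2 > 0"
      using e that by (auto simp: t_def mult_le_0_iff)
    then have "(q i + t) * (q j - t) - q i * q j < 0"
      by (simp add: power2_eq_square algebra_simps)
    then have "((q i + t) * (q j - t) - q i * q j) * interaction A q x i j > 0"
      using neg[OF that] by (simp add: mult_neg_neg)
    moreover have "tail A (q(i := q i + t, j := q j - t)) x =
        tail A q x + ((q i + t) * (q j - t) - q i * q j) * interaction A q x i j"
      using tail_redistribute[of A i j q "q i + t" "q j - t" x] fin that ij q01 t by simp
    moreover have "q(i := q i + t, j := q j - t) \<in> D"
      using upd[of i j "q i + t" "q j - t"] t that ij by simp
    ultimately show False using qmax by fastforce
  qed
  have "tail A p x = tail A p0 x"
    by (rule tail_cong) (simp add: p0_def)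
  then have "tail A p x \<le> tail A q x" using qmax[OF p0] by simp
  then show ?thesis
    using that[of q] q01 neg bdry qD by (auto simp: D_def)
qed


section \<open>Tails of binomial laws\<close>

lemma binomial_tail_no_trials:
  assumes "a \<in> {0..1}"
  shows "binomial_tail 0 a x = of_bool (x = 0)"
  using tail_binomial[of "{}" a x] assms by (simp add: tail_empty)

lemma binomial_tail_Suc:
  assumes "a \<in> {0..1}"
  shows "binomial_tail (Suc m) a x = a * binomial_tail m a (x - 1) + (1 - a) * binomial_tail m a x"
proof -
  have "tail (insert m {..<m}) (\<lambda>_. a) x
      = a * tail {..<m} (\<lambda>_. a) (x - 1) + (1 - a) * tail {..<m} (\<lambda>_. a) x"
    using assms by (intro tail_insert) auto
  then show ?thesis
    using assms by (simp add: tail_binomial)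
qed

lemma binomial_tail_at_0 [simp]: "binomial_tail m a 0 = 1"
proof -
  have "{0::nat..} = UNIV" by auto
  then show ?thesis by (simp add: binomial_tail_def)
qed

lemma binomial_tail_antimono: "x \<le> y \<Longrightarrow> binomial_tail m a y \<le> binomial_tail m a x"
  unfolding binomial_tail_def by (intro measure_pmf.finite_measure_mono) auto

lemma binomial_tail_beyond:
  assumes "a \<in> {0..1}" "m < x"
  shows "binomial_tail m a x = 0"
  using assms(2)
proof (induction m arbitrary: x)
  case 0
  then show ?case using assms(1) by (simp add: binomial_tail_no_trials)
next
  case (Suc m)
  then show ?case using assms(1) by (simp add: binomial_tail_Suc)
qed

lemma binomial_tail_top:
  assumes "a \<in> {0..1}"
  shows "binomial_tail m a m = a ^ m"
proof (induction m)
  case (Suc m)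
  then show ?case using assms by (simp add: binomial_tail_Suc binomial_tail_beyond)
qed simp

lemma binomial_tail_1:
  assumes "a \<in> {0..1}"
  shows "binomial_tail m a 1 = 1 - (1 - a) ^ m"
proof (induction m)
  case 0
  then show ?case using assms by (simp add: binomial_tail_beyond)
next
  case (Suc m)
  then show ?case using assms by (simp add: binomial_tail_Suc Suc.IH[simplified]) (simp add: algebra_simps)
qed

lemma binomial_tail_at_prob_0: "x \<ge> 1 \<Longrightarrow> binomial_tail m 0 x = 0"
  by (induction m) (simp_all add: binomial_tail_Suc binomial_tail_beyond)

lemma binomial_tail_at_prob_1: "x \<le> m \<Longrightarrow> binomial_tail m 1 x = 1"
proof (induction m arbitrary: x)
  case (Suc m)
  then show ?case by (simp add: binomial_tail_Suc)
qed simp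

lemma continuous_binomial_tail: "continuous_on {0..1} (\<lambda>a. binomial_tail m a x)"
proof (induction m arbitrary: x)
  case 0
  have "continuous_on {0..1} (\<lambda>a :: real. of_bool (x = 0) :: real)" by simp
  then show ?case by (rule continuous_on_eq) (simp add: binomial_tail_no_trials)
next
  case (Suc m)
  have "continuous_on {0..1} (\<lambda>a. a * binomial_tail m a (x - 1) + (1 - a) * binomial_tail m a x)"
    by (intro continuous_intros Suc)
  then show ?case
    by (rule continuous_on_eq) (simp add: binomial_tail_Suc)
qed

text \<open>By induction over the trials: conditioning on the last one, first the law of the other trials is raised
from \<open>a\<close> to \<open>b\<close>, and then the last trial itself, which can only help since the tail decreases in \<open>x\<close>.
The first change is strict unless all trials must succeed, where the tail is the power \<open>a ^ (m + 1)\<close>.\<close>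

lemma binomial_tail_strict_mono:
  assumes "0 \<le> a" "a < b" "b \<le> 1" "1 \<le> x" "x \<le> m"
  shows "binomial_tail m a x < binomial_tail m b x"
  using assms(4,5)
proof (induction m arbitrary: x)
  case (Suc m)
  have le: "binomial_tail m a y \<le> binomial_tail m b y" for y
    using Suc.IH[of y] assms binomial_tail_beyond[of a m y] binomial_tail_beyond[of b m y]
    by (cases "y = 0"; cases "y \<le> m") auto
  have ab: "a \<in> {0..1}" "b \<in> {0..1}" using assms by auto
  show ?case
  proof (cases "x = Suc m")
    case True
    then show ?thesis
      using assms binomial_tail_top[OF ab(1), of "Suc m"] binomial_tail_top[OF ab(2), of "Suc m"]
        power_strict_mono[of a b "Suc m"] by simp
  next
    case False
    have "a * binomial_tail m a (x - 1) + (1 - a) * binomial_tail m a x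
        < a * binomial_tail m b (x - 1) + (1 - a) * binomial_tail m b x"
      using Suc False assms le[of "x - 1"]
      by (intro add_le_less_mono mult_left_mono mult_strict_left_mono) auto
    also have "\<dots> = binomial_tail m b x + a * (binomial_tail m b (x - 1) - binomial_tail m b x)"
      by (simp add: algebra_simps)
    also have "\<dots> \<le> binomial_tail m b x + b * (binomial_tail m b (x - 1) - binomial_tail m b x)"
      using assms binomial_tail_antimono[of "x - 1" x m b] by (intro add_left_mono mult_right_mono) auto
    finally show ?thesis using ab by (simp add: binomial_tail_Suc algebra_simps)
  qed
qed simp

lemma binomial_tail_mono:
  assumes "0 \<le> a" "a \<le> b" "b \<le> 1"
  shows "binomial_tail m a x \<le> binomial_tail m b x"
  using binomial_tail_strict_mono[of a b x m] assms binomial_tail_beyond[of a m x] binomial_tail_beyond[of b m x]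
  by (cases "x = 0"; cases "x \<le> m"; cases "a = b") auto

lemma binomial_tail_diff: "binomial_tail m a x - binomial_tail m a (Suc x) = pmf (binomial_pmf m a) x"
proof -
  have "{x..} = insert x {Suc x..}" by auto
  then have "binomial_tail m a x = pmf (binomial_pmf m a) x + binomial_tail m a (Suc x)"
    unfolding binomial_tail_def
    by (simp add: measure_pmf.finite_measure_Union[of "{x}" _ "{Suc x..}", simplified] measure_pmf_single)
  then show ?thesis by simp
qed

text \<open>The ratio of consecutive weights is \<open>(m - x) * a / ((x + 1) * (1 - a))\<close>, which is at most 1 exactly under
the stated condition.\<close>

lemma binomial_pmf_decreasing:
  assumes a: "a \<in> {0..1}" and le: "real (m + 1) * a \<le> real (x + 1)"
  shows "pmf (binomial_pmf m a) (x + 1) \<le> pmf (binomial_pmf m a) x"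
proof (cases "x < m")
  case False
  then show ?thesis using a by (simp add: binomial_eq_0)
next
  case True
  then obtain d where m: "m = x + 1 + d" using less_imp_add_positive by (metis Suc_eq_plus1 add.assoc add.commute less_iff_Suc_add)
  have "real (m choose (x + 1)) * real (x + 1) = real (m choose x) * real (m - x)"
    using binomial_absorb_comp[of m x] binomial_absorption[of x m] Suc_times_binomial_add
    by (metis (no_types, lifting) Suc_eq_plus1 binomial_absorb_comp binomial_absorption mult.commute of_nat_mult m)
  then have "(real (m choose (x + 1)) * a) * real (x + 1) = real (m choose x) * (real (m - x) * a)"
    by (simp add: algebra_simps)
  also have "\<dots> \<le> real (m choose x) * (real (x + 1) * (1 - a))"
    using le m by (intro mult_left_mono) (auto simp: algebra_simps)
  finally have "(real (m choose (x + 1)) * a) * real (x + 1) \<le> (real (m choose x) * (1 - a)) * real (x + 1)"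
    by (simp add: algebra_simps)
  then have "real (m choose (x + 1)) * a \<le> real (m choose x) * (1 - a)"
    by (rule mult_right_le_imp_le) simp
  then have "(real (m choose (x + 1)) * a) * (a ^ x * (1 - a) ^ d) \<le> (real (m choose x) * (1 - a)) * (a ^ x * (1 - a) ^ d)"
    using a by (intro mult_right_mono) auto
  then show ?thesis using a m by (simp add: algebra_simps)
qed


section \<open>Hoeffding's extremal laws\<close>

text \<open>The interaction of two trials when, of the remaining ones, \<open>l\<close> succeed surely, \<open>m\<close> have success probability
\<open>a\<close>, and the others fail surely.\<close>

definition binomial_interaction :: "nat \<Rightarrow> real \<Rightarrow> nat \<Rightarrow> nat \<Rightarrow> real" where
  "binomial_interaction m a x l =
     binomial_tail m a (x - 2 - l) - 2 * binomial_tail m a (x - 1 - l) + binomial_tail m a (x - l)"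

text \<open>Being a second difference of tails, the interaction is the difference of two consecutive binomial weights.
These decrease beyond the mode, that is, when \<open>x\<close> is large compared with the mean.\<close>

lemma binomial_interaction_nonneg:
  assumes a: "a \<in> {0..1}" and le: "l + 2 \<le> x" "real (m + 1) * a + real l + 1 \<le> real x"
  shows "0 \<le> binomial_interaction m a x l"
proof -
  obtain y where y: "x = l + 2 + y" using le(1) le_Suc_ex by blast
  have "pmf (binomial_pmf m a) (y + 1) \<le> pmf (binomial_pmf m a) y"
    by (rule binomial_pmf_decreasing[OF a]) (use le(2) y in simp)
  then show ?thesis
    using binomial_tail_diff[of m a y] binomial_tail_diff[of m a "Suc y"]
    by (simp add: binomial_interaction_def y del: pmf_binomial)
qed

text \<open>Hoeffding's theorem on the extremal laws with a given mean: all coordinates of an extremal vector that are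
neither 0 nor 1 coincide. The last three conclusions keep the sign of the interaction for each pair of
distinct values, namely 1 and 0, \<open>a\<close> and 0, 1 and \<open>a\<close>; they are what excludes mixed vectors in the sharper bound below.\<close>

lemma hoeffding_extremal:
  assumes fin: "finite A" and p: "\<And>i. i \<in> A \<Longrightarrow> p i \<in> {0..1}"
  obtains l m z a where "l + m + z = card A" "a \<in> {0..1}" "m > 0 \<Longrightarrow> 0 < a"
    "sum p A = real l + real m * a"
    "tail A p x \<le> binomial_tail m a (x - l)"
    "l > 0 \<Longrightarrow> z > 0 \<Longrightarrow> binomial_interaction m a x (l - 1) < 0"
    "m > 0 \<Longrightarrow> z > 0 \<Longrightarrow> binomial_interaction (m - 1) a x l < 0"
    "l > 0 \<Longrightarrow> m > 0 \<Longrightarrow> binomial_interaction (m - 1) a x (l - 1) < 0"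
proof -
  obtain q where q01: "\<And>i. i \<in> A \<Longrightarrow> q i \<in> {0..1}" and sum: "sum q A = sum p A"
    and le: "tail A p x \<le> tail A q x"
    and neg: "\<And>i j. i \<in> A \<Longrightarrow> j \<in> A \<Longrightarrow> q i \<noteq> q j \<Longrightarrow> interaction A q x i j < 0"
    and bdry: "\<And>i j. i \<in> A \<Longrightarrow> j \<in> A \<Longrightarrow> q i \<noteq> q j \<Longrightarrow> q i \<in> {0, 1} \<or> q j \<in> {0, 1}"
    by (rule exists_extremal[where A = A and p = p and x = x]) (use fin p in auto)
  define L where "L = {i\<in>A. q i = 1}"
  define Z where "Z = {i\<in>A. q i = 0}"
  define M where "M = {i\<in>A. q i \<noteq> 0 \<and> q i \<noteq> 1}"
  obtain a where a: "a \<in> {0..1}" "\<And>i. i \<in> M \<Longrightarrow> q i = a" "M \<noteq> {} \<Longrightarrow> 0 < a \<and> a < 1"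
  proof (cases "M = {}")
    case True
    then show ?thesis using that[of 0] by auto
  next
    case False
    then obtain k where k: "k \<in> M" by auto
    have "0 < q k \<and> q k < 1" using q01[of k] k by (auto simp: M_def)
    moreover have "q i = q k" if "i \<in> M" for i
      using bdry[of i k] that k by (auto simp: M_def)
    ultimately show ?thesis using that[of "q k"] by auto
  qed
  have A: "A = L \<union> M \<union> Z" by (auto simp: L_def M_def Z_def)
  have disj: "L \<inter> M = {}" "L \<inter> Z = {}" "M \<inter> Z = {}" by (auto simp: L_def M_def Z_def)
  have fins: "finite L" "finite M" "finite Z" using fin by (auto simp: L_def M_def Z_def)
  have qL: "\<And>i. i \<in> L \<Longrightarrow> q i = 1" and qZ: "\<And>i. i \<in> Z \<Longrightarrow> q i = 0" by (auto simp: L_def Z_def)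
  have t: "tail (L' \<union> M' \<union> Z') q y = binomial_tail (card M') a (y - card L')"
    if "L' \<subseteq> L" "M' \<subseteq> M" "Z' \<subseteq> Z" for L' M' Z' y
    by (rule tail_ones_zeros) (use that disj fins qL qZ a in \<open>auto intro: finite_subset\<close>)
  have I: "interaction A q x i j = binomial_interaction (card M') a x (card L')"
    if "A - {i, j} = L' \<union> M' \<union> Z'" "L' \<subseteq> L" "M' \<subseteq> M" "Z' \<subseteq> Z" for i j L' M' Z'
    unfolding interaction_def binomial_interaction_def that(1) t[OF that(2-4)] by simp
  show ?thesis
  proof (rule that)
    show "card L + card M + card Z = card A"
      unfolding A using fins disj by (subst card_Un_disjoint, auto)+
    show "a \<in> {0..1}" "0 < card M \<Longrightarrow> 0 < a" using a by (auto simp: card_gt_0_iff)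
    have "sum q A = sum q L + sum q M + sum q Z"
      unfolding A using fins disj by (subst sum.union_disjoint, auto)+
    then show "sum p A = real (card L) + real (card M) * a"
      using sum qL qZ a(2) by simp
    show "tail A p x \<le> binomial_tail (card M) a (x - card L)"
      using le t[of L M Z x] A by simp
    show "binomial_interaction (card M) a x (card L - 1) < 0" if "0 < card L" "0 < card Z"
    proof -
      obtain i j where ij: "i \<in> L" "j \<in> Z" using \<open>0 < card L\<close> \<open>0 < card Z\<close> by fastforce
      then have "interaction A q x i j < 0" using neg[of i j] by (auto simp: L_def Z_def)
      moreover have "A - {i, j} = (L - {i}) \<union> M \<union> (Z - {j})" using A ij disj by auto
      ultimately show ?thesis using I[of i j "L - {i}" M "Z - {j}"] ij fins by auto
    qed
    show "binomial_interaction (card M - 1) a x (card L) < 0" if "0 < card M" "0 < card Z"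
    proof -
      obtain i j where ij: "i \<in> M" "j \<in> Z" using \<open>0 < card M\<close> \<open>0 < card Z\<close> by fastforce
      then have "interaction A q x i j < 0" using neg[of i j] by (auto simp: M_def Z_def)
      moreover have "A - {i, j} = L \<union> (M - {i}) \<union> (Z - {j})" using A ij disj by auto
      ultimately show ?thesis using I[of i j L "M - {i}" "Z - {j}"] ij fins by auto
    qed
    show "binomial_interaction (card M - 1) a x (card L - 1) < 0" if "0 < card L" "0 < card M"
    proof -
      obtain i j where ij: "i \<in> L" "j \<in> M" using \<open>0 < card L\<close> \<open>0 < card M\<close> by fastforce
      then have "interaction A q x i j < 0" using neg[of i j] by (auto simp: M_def L_def)
      moreover have "A - {i, j} = (L - {i}) \<union> (M - {j}) \<union> Z" using A ij disj by auto
      ultimately show ?thesis using I[of i j "L - {i}" "M - {j}" Z] ij fins by auto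
    qed
  qed
qed

text \<open>For an expected number of successes at most \<open>x - 1\<close>, any two distinct values in a three-valued vector have
interaction at least 0, so the extremal vector of Hoeffding's theorem must be constant.\<close>

lemma tail_le_binomial_tail:
  assumes fin: "finite A" and p: "\<And>i. i \<in> A \<Longrightarrow> p i \<in> {0..1}"
    and ne: "A \<noteq> {}" and le: "sum p A \<le> real x - 1"
  shows "tail A p x \<le> binomial_tail (card A) (sum p A / real (card A)) x"
proof -
  obtain l m z a where lmz: "l + m + z = card A" and a: "a \<in> {0..1}" "m > 0 \<Longrightarrow> 0 < a"
    and sum: "sum p A = real l + real m * a"
    and t: "tail A p x \<le> binomial_tail m a (x - l)"
    and lz: "l > 0 \<Longrightarrow> z > 0 \<Longrightarrow> binomial_interaction m a x (l - 1) < 0"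
    and mz: "m > 0 \<Longrightarrow> z > 0 \<Longrightarrow> binomial_interaction (m - 1) a x l < 0"
    and lm: "l > 0 \<Longrightarrow> m > 0 \<Longrightarrow> binomial_interaction (m - 1) a x (l - 1) < 0"
    by (rule hoeffding_extremal[where A = A and p = p and x = x]) (use fin p in auto)
  have ma: "real m * a \<ge> 0" using a by simp
  then have lx: "l + 1 \<le> x" using le sum by linarith
  have nonneg: "0 \<le> binomial_tail k b y" for k b y by (simp add: binomial_tail_def)
  \<comment> \<open>Sure successes and sure failures cannot coexist.\<close>
  have "\<not> (l > 0 \<and> z > 0)"
  proof
    assume *: "l > 0 \<and> z > 0"
    have "0 \<le> binomial_interaction m a x (l - 1)"
      by (rule binomial_interaction_nonneg[OF a(1)])
        (use * lx le sum a in \<open>auto simp: algebra_simps of_nat_diff\<close>)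
    then show False using lz * by simp
  qed
  \<comment> \<open>Neither can sure successes and trials with the intermediate probability.\<close>
  moreover have "\<not> (l > 0 \<and> m > 0)"
  proof
    assume *: "l > 0 \<and> m > 0"
    have "0 \<le> binomial_interaction (m - 1) a x (l - 1)"
      by (rule binomial_interaction_nonneg[OF a(1)])
        (use * lx le sum a in \<open>auto simp: algebra_simps of_nat_diff\<close>)
    then show False using lm * by simp
  qed
  \<comment> \<open>In the last mixed case the mean is positive, which forces \<open>x \<ge> 2\<close>, as the interaction bound requires.\<close>
  moreover have "\<not> (l = 0 \<and> m > 0 \<and> z > 0)"
  proof
    assume *: "l = 0 \<and> m > 0 \<and> z > 0"
    then have "real m * a > 0" using a by simp
    then have "x \<ge> 2" using * le sum by simp
    then have "0 \<le> binomial_interaction (m - 1) a x l"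
      by (intro binomial_interaction_nonneg[OF a(1)])
        (use * le sum in \<open>auto simp: algebra_simps of_nat_diff\<close>)
    then show False using mz * by simp
  qed
  ultimately consider "m = 0" | "m = card A" "l = 0"
    using lmz by linarith
  then show ?thesis
  proof cases
    case 1
    then have "tail A p x \<le> 0" using t lx a by (simp add: binomial_tail_no_trials)
    then show ?thesis using nonneg order_trans by blast
  next
    case 2
    then show ?thesis using t sum fin ne by simp
  qed
qed

text \<open>Restricted to \<open>{1..n}\<close>, since the points of the unit cube are extensional functions.\<close>

definition three_valued :: "nat \<Rightarrow> nat \<Rightarrow> nat \<Rightarrow> real \<Rightarrow> nat \<Rightarrow> real" where
  "three_valued n l m b = (\<lambda>i\<in>{1..n}. if i \<le> l then 1 else if i \<le> l + m then b else 0)"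

lemma three_valued:
  assumes "l + m \<le> n" and b: "b \<in> {0..1}"
  shows three_valued_in_unit_cube: "three_valued n l m b \<in> unit_cube n"
    and sum_three_valued: "(\<Sum>i\<in>{1..n}. three_valued n l m b i) = real l + real m * b"
    and tail_three_valued: "tail {1..n} (three_valued n l m b) x = binomial_tail m b (x - l)"
proof -
  let ?p = "three_valued n l m b"
  show "?p \<in> unit_cube n" using b by (auto simp: unit_cube_def three_valued_def)
  have A: "{1..n} = {1..l} \<union> {l+1..l+m} \<union> {l+m+1..n}" using assms(1) by auto
  have v: "\<And>i. i \<in> {1..l} \<Longrightarrow> ?p i = 1" "\<And>i. i \<in> {l+1..l+m} \<Longrightarrow> ?p i = b"
    "\<And>i. i \<in> {l+m+1..n} \<Longrightarrow> ?p i = 0"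
    using assms(1) by (auto simp: three_valued_def)
  have "sum ?p {1..n} = sum ?p {1..l} + sum ?p {l+1..l+m} + sum ?p {l+m+1..n}"
    unfolding A by (subst sum.union_disjoint, auto)+
  also have "\<dots> = sum (\<lambda>_. 1) {1..l} + sum (\<lambda>_. b) {l+1..l+m} + sum (\<lambda>_. 0) {l+m+1..n}"
    using v by (intro arg_cong2[where f = "(+)"] sum.cong) auto
  finally show "sum ?p {1..n} = real l + real m * b" by simp
  have "tail ({1..l} \<union> {l+1..l+m} \<union> {l+m+1..n}) ?p x = binomial_tail (card {l+1..l+m}) b (x - card {1..l})"
    by (rule tail_ones_zeros) (use v b in auto)
  then show "tail {1..n} ?p x = binomial_tail m b (x - l)" using A by simp
qed


section \<open>Clopper-Pearson bounds\<close>

lemma prob_atLeastAtMost_binomial: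
  assumes "a \<in> {0..1}"
  shows "measure_pmf.prob (binomial_pmf m a) {x..m} = binomial_tail m a x"
proof -
  have "{x..m} \<inter> set_pmf (binomial_pmf m a) = {x..} \<inter> set_pmf (binomial_pmf m a)"
    using assms by (auto simp: set_pmf_binomial_eq split: if_splits)
  then show ?thesis
    unfolding binomial_tail_def by (metis measure_Int_set_pmf)
qed

lemma cp_bound:
  assumes "1 \<le> x" "x \<le> m" "0 < \<beta>" "\<beta> < 1"
  shows cp_bound_in: "0 < cp_bound \<beta> m x" "cp_bound \<beta> m x < 1"
    and binomial_tail_cp_bound: "binomial_tail m (cp_bound \<beta> m x) x = 1 - \<beta>"
proof -
  have ends: "binomial_tail m 0 x = 0" "binomial_tail m 1 x = 1"
    using assms by (simp_all add: binomial_tail_at_prob_0 binomial_tail_at_prob_1)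
  obtain g where g: "0 \<le> g" "g \<le> 1" "binomial_tail m g x = 1 - \<beta>"
    using IVT'[of "\<lambda>a. binomial_tail m a x" 0 "1 - \<beta>" 1] continuous_binomial_tail ends assms by auto
  have "cp_bound \<beta> m x = g"
    unfolding cp_bound_def
  proof (rule the_equality)
    show "g \<in> {0..1} \<and> measure_pmf.prob (binomial_pmf m g) {x..m} = 1 - \<beta>"
      using g by (simp add: prob_atLeastAtMost_binomial)
    fix p assume "p \<in> {0..1} \<and> measure_pmf.prob (binomial_pmf m p) {x..m} = 1 - \<beta>"
    then have p: "0 \<le> p" "p \<le> 1" "binomial_tail m p x = 1 - \<beta>"
      by (auto simp: prob_atLeastAtMost_binomial)
    show "p = g"
      using binomial_tail_strict_mono[of p g x m] binomial_tail_strict_mono[of g p x m] p g assms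
      by (cases p g rule: linorder_cases) auto
  qed
  moreover have "g \<noteq> 0" "g \<noteq> 1" using g ends assms by auto
  ultimately show "0 < cp_bound \<beta> m x" "cp_bound \<beta> m x < 1" "binomial_tail m (cp_bound \<beta> m x) x = 1 - \<beta>"
    using g by auto
qed

lemma binomial_tail_le_iff_cp_bound:
  assumes "1 \<le> x" "x \<le> m" "0 < \<beta>" "\<beta> < 1" "b \<in> {0..1}"
  shows "binomial_tail m b x \<le> 1 - \<beta> \<longleftrightarrow> b \<le> cp_bound \<beta> m x"
  using cp_bound[OF assms(1-4)] assms
    binomial_tail_strict_mono[of "cp_bound \<beta> m x" b x m] binomial_tail_mono[of b "cp_bound \<beta> m x" m x]
  by (cases "b \<le> cp_bound \<beta> m x") auto

lemma cp_bound_strict_mono: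
  assumes "1 \<le> x" "x < y" "y \<le> m" "0 < \<beta>" "\<beta> < 1"
  shows "cp_bound \<beta> m x < cp_bound \<beta> m y"
proof -
  let ?g = "cp_bound \<beta> m y"
  have g: "0 < ?g" "?g < 1" "binomial_tail m ?g y = 1 - \<beta>"
    using cp_bound[of y m \<beta>] assms by auto
  have "0 < pmf (binomial_pmf m ?g) x" using g assms by simp
  then have "binomial_tail m ?g (Suc x) < binomial_tail m ?g x"
    using binomial_tail_diff[of m ?g x] by linarith
  moreover have "1 - \<beta> \<le> binomial_tail m ?g (Suc x)"
    using binomial_tail_antimono[of "Suc x" y m ?g] assms g by simp
  ultimately show ?thesis
    using binomial_tail_le_iff_cp_bound[of x m \<beta> ?g] assms g by auto
qed

section \<open>Coverage probabilities and tails\<close>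

lemma bernoulli_conv_eq: "bernoulli_conv n p = poisson_binomial {1..n} p"
  by (simp add: bernoulli_conv_def poisson_binomial_def)

lemma set_poisson_binomial:
  assumes "finite A"
  shows "set_pmf (poisson_binomial A p) \<subseteq> {0..card A}"
proof -
  have "(\<Sum>j\<in>A. of_bool (f j)) \<le> card A" for f :: "'a \<Rightarrow> bool"
    using sum_bounded_above[of A "\<lambda>j. of_bool (f j)" "1::nat"] by simp
  then show ?thesis by (auto simp: poisson_binomial_def)
qed

lemma tail_beyond:
  assumes "finite A" "card A < x"
  shows "tail A p x = 0"
  unfolding tail_def measure_pmf_zero_iff using set_poisson_binomial[OF assms(1), of p] assms(2) by auto

lemma prob_below: "measure_pmf.prob (poisson_binomial A p) {..<x} = 1 - tail A p x"
proof -
  have "{..<x} = space (measure_pmf (poisson_binomial A p)) - {x..}" by auto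
  then show ?thesis unfolding tail_def by (simp only: measure_pmf.prob_compl sets_measure_pmf UNIV_I)
qed

lemma coverage_le:
  assumes "\<And>y. x \<le> y \<Longrightarrow> y \<le> n \<Longrightarrow> avg n p \<notin> K y"
  shows "coverage n K p \<le> 1 - tail {1..n} p x"
  unfolding coverage_def bernoulli_conv_eq prob_below[symmetric]
  by (rule measure_pmf.finite_measure_mono) (use assms not_le in auto)

lemma coverage_ge:
  assumes "\<And>y. y < x \<Longrightarrow> y \<le> n \<Longrightarrow> avg n p \<in> K y"
  shows "1 - tail {1..n} p x \<le> coverage n K p"
proof -
  have "{..<x} \<inter> set_pmf (poisson_binomial {1..n} p) \<subseteq> {y \<in> {0..n}. avg n p \<in> K y}"
    using set_poisson_binomial[of "{1..n}" p] assms by auto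
  then show ?thesis
    unfolding coverage_def bernoulli_conv_eq prob_below[symmetric]
    by (subst measure_Int_set_pmf[symmetric]) (rule measure_pmf.finite_measure_mono, auto)
qed


section \<open>Binomial laws with integer mean\<close>

lemma prob_binomial_below: "measure_pmf.prob (binomial_pmf m a) {..<x} = 1 - binomial_tail m a x"
proof -
  have "{..<x} = space (measure_pmf (binomial_pmf m a)) - {x..}" by auto
  then show ?thesis unfolding binomial_tail_def by (simp only: measure_pmf.prob_compl sets_measure_pmf UNIV_I)
qed

text \<open>The power decreases to \<open>exp (-1)\<close>, and 25/68 is the reciprocal of the bound 2.72 for \<open>exp 1\<close>.\<close>

lemma power_one_minus_inverse_ge:
  fixes n :: nat
  assumes "2 \<le> n"
  shows "25 / 68 \<le> (1 - 1 / real n) ^ (n - 1)"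
proof -
  define k where "k = n - 1"
  have k: "0 < k" "n = Suc k" using assms by (auto simp: k_def)
  have "(1 + 1 / real k) ^ k \<le> exp (1 / real k) ^ k"
    by (intro power_mono exp_ge_add_one_self) (auto simp: add_nonneg_nonneg)
  also have "\<dots> = exp 1" using k by (simp flip: exp_of_nat_mult)
  also have "\<dots> \<le> 68 / 25" using e_less_272 by simp
  finally have "(1 + 1 / real k) ^ k \<le> 68 / 25" .
  moreover have "0 < (1 + 1 / real k) ^ k" by (intro zero_less_power) (simp add: add_pos_nonneg)
  ultimately have "1 / (68 / 25) \<le> 1 / (1 + 1 / real k) ^ k" by (intro divide_left_mono) auto
  moreover have "1 - 1 / real n = 1 / (1 + 1 / real k)" using k by (simp add: field_simps)
  then have "(1 - 1 / real n) ^ (n - 1) = 1 / (1 + 1 / real k) ^ k"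
    unfolding k_def[symmetric] by (simp add: power_one_over)
  ultimately show ?thesis by simp
qed

lemma binomial_tail_one_over:
  assumes "1 \<le> n"
  shows "binomial_tail n (1 / real n) 2 = 1 - (1 - 1 / real n) ^ (n - 1) * (2 - 1 / real n)"
proof -
  have a: "1 / real n \<in> {0..1}" using assms by auto
  have "binomial_tail n (1 / real n) 1 - binomial_tail n (1 / real n) 2 = (1 - 1 / real n) ^ (n - 1)"
    using binomial_tail_diff[of n "1 / real n" 1] a assms by (simp add: numeral_2_eq_2)
  moreover have "(1 - 1 / real n) ^ n = (1 - 1 / real n) ^ (n - 1) * (1 - 1 / real n)"
    using assms by (cases n) auto
  ultimately show ?thesis
    using binomial_tail_1[OF a, of n] by (simp add: algebra_simps)
qed

text \<open>The tail increases with \<open>n\<close> towards \<open>1 - 2 / exp 1\<close>, about 0.264, so 5/16 leaves enough room for the crude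
estimate of \<open>exp 1\<close> once \<open>n \<ge> 8\<close>; the few smaller cases are computed.\<close>

lemma binomial_tail_one_over_le:
  assumes "4 \<le> n"
  shows "binomial_tail n (1 / real n) 2 \<le> 5 / 16"
proof (cases "8 \<le> n")
  case True
  have "(25 / 68) * (15 / 8) \<le> (1 - 1 / real n) ^ (n - 1) * (2 - 1 / real n)"
    using power_one_minus_inverse_ge[of n] True by (intro mult_mono) (auto simp: field_simps)
  then have "11 / 16 \<le> (1 - 1 / real n) ^ (n - 1) * (2 - 1 / real n)"
    by (rule order_trans[rotated]) simp
  moreover have "1 \<le> n" using True by simp
  ultimately show ?thesis unfolding binomial_tail_one_over[OF \<open>1 \<le> n\<close>] by linarith
next
  case False
  then have "n = 4 \<or> n = 5 \<or> n = 6 \<or> n = 7" using assms by linarith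
  moreover have "binomial_tail n (1 / real n) 2 = 1 - (1 - 1 / real n) ^ (n - 1) * (2 - 1 / real n)"
    using assms by (intro binomial_tail_one_over) simp
  ultimately show ?thesis by (elim disjE) (simp_all add: power_divide)
qed

lemma binomial_tail_one_over_le_top:
  assumes "2 \<le> n"
  shows "binomial_tail n (1 / real n) 2 \<le> binomial_tail n (1 - 1 / real n) n"
proof -
  have top: "binomial_tail n (1 - 1 / real n) n = (1 - 1 / real n) ^ (n - 1) * (1 - 1 / real n)"
    using assms binomial_tail_top[of "1 - 1 / real n" n] by (cases n) auto
  have "1 \<le> (1 - 1 / real n) ^ (n - 1) * (3 - 2 / real n)"
  proof (cases "8 \<le> n")
    case True
    have "(25 / 68) * (11 / 4) \<le> (1 - 1 / real n) ^ (n - 1) * (3 - 2 / real n)"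
      using power_one_minus_inverse_ge[of n] True by (intro mult_mono) (auto simp: field_simps)
    then show ?thesis by (rule order_trans[rotated]) simp
  next
    case False
    then have "n = 2 \<or> n = 3 \<or> n = 4 \<or> n = 5 \<or> n = 6 \<or> n = 7" using assms by linarith
    then show ?thesis by (elim disjE) (simp_all add: power_divide)
  qed
  then show ?thesis using assms top by (simp add: binomial_tail_one_over algebra_simps)
qed

text \<open>The vector of \<open>k - 2\<close> ones, four times 1/2 and zeros otherwise also has sum \<open>k\<close>, and its tail at \<open>k + 1\<close>
is the probability 5/16 of at least three heads in four fair coin tosses. By the sharp form of Hoeffding's
theorem the binomial tail is at least as large.\<close>

lemma binomial_tail_above_mean_ge:
  assumes "2 \<le> k" "k + 2 \<le> n"
  shows "5 / 16 \<le> binomial_tail n (real k / real n) (k + 1)"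
proof -
  let ?p = "three_valued n (k - 2) 4 (1 / 2)"
  have lm: "k - 2 + 4 \<le> n" "(1 / 2 :: real) \<in> {0..1}" using assms by auto
  have sum: "sum ?p {1..n} = real k"
    using three_valued(2)[OF lm] assms by (simp add: of_nat_diff)
  have "binomial_tail 4 (1 / 2) 3 = (5 / 16 :: real)"
    using binomial_tail_diff[of 4 "1 / 2" 3] binomial_tail_top[of "1 / 2" 4]
    by (simp add: power_divide eval_nat_numeral)
  moreover have "k + 1 - (k - 2) = 3" using assms by simp
  ultimately have "5 / 16 = tail {1..n} ?p (k + 1)"
    using three_valued(3)[OF lm, of "k + 1"] by simp
  also have "\<dots> \<le> binomial_tail (card {1..n}) (sum ?p {1..n} / real (card {1..n})) (k + 1)"
    using three_valued(1)[OF lm] assms sum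
    by (intro tail_le_binomial_tail) (auto simp: unit_cube_def PiE_def Pi_def)
  finally show ?thesis unfolding sum by simp
qed

text \<open>The tail need not be monotone in \<open>k\<close>: for large \<open>n\<close> it rises at first and falls again as \<open>k\<close> approaches \<open>n\<close>. For
\<open>2 \<le> k \<le> n - 2\<close> the constant 5/16 separates it from its value at \<open>k = 1\<close>, and only \<open>k = n - 1\<close> remains for a
direct comparison.\<close>

lemma binomial_tail_above_mean:
  assumes "1 \<le> k" "k < n"
  shows "binomial_tail n (1 / real n) 2 \<le> binomial_tail n (real k / real n) (k + 1)"
proof -
  consider "k = 1" | "k = n - 1" | "2 \<le> k" "k + 2 \<le> n" using assms by linarith
  then show ?thesis
  proof cases
    case 1
    then show ?thesis by (simp add: numeral_2_eq_2)
  next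
    case 2
    then have "real k / real n = 1 - 1 / real n" "k + 1 = n" "2 \<le> n"
      using assms by (auto simp: field_simps of_nat_diff)
    then show ?thesis using binomial_tail_one_over_le_top[of n] by simp
  next
    case 3
    then show ?thesis
      using binomial_tail_one_over_le[of n] binomial_tail_above_mean_ge[of k n] by simp
  qed
qed

section \<open>The upray built from Clopper-Pearson bounds\<close>

locale average_success =
  fixes n :: nat and \<beta> :: real and K :: "nat \<Rightarrow> real set"
  assumes n: "1 \<le> n" and \<beta>: "0 < \<beta>" "\<beta> < 1"
    and K_eq: "\<And>x. x \<in> {0..n} \<Longrightarrow>
      K x = (\<Union>l\<in>{0..x}. \<Union>m\<in>{x - l..n - l}.
               (\<lambda>a. real m / real n * a + real l / real n) ` cp_upray \<beta> m (x - l))"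
begin

text \<open>A candidate describes a vector of \<open>l\<close> ones, \<open>m\<close> coordinates sharing a value in \<open>(0,1)\<close>, and zeros otherwise, for which
the event of at least \<open>x\<close> successes is neither sure nor impossible. The index \<open>l = x\<close> of the union defining \<open>K x\<close> is left out:
it only contributes averages from \<open>x / n\<close> on, which lie above the bound of a candidate.\<close>

definition candidate :: "nat \<Rightarrow> nat \<Rightarrow> nat \<Rightarrow> bool" where
  "candidate x l m \<longleftrightarrow> l < x \<and> x - l \<le> m \<and> m \<le> n - l"

definition candidate_bound :: "nat \<Rightarrow> nat \<Rightarrow> nat \<Rightarrow> real" where
  "candidate_bound x l m = (real m * cp_bound \<beta> m (x - l) + real l) / real n"

definition bound :: "nat \<Rightarrow> real" where
  "bound x = Min {candidate_bound x l m | l m. candidate x l m}"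

lemma finite_candidates: "finite {candidate_bound x l m | l m. candidate x l m}"
proof -
  have "{candidate_bound x l m | l m. candidate x l m}
      \<subseteq> (\<lambda>(l, m). candidate_bound x l m) ` ({..<x} \<times> {..n})"
    by (auto simp: candidate_def)
  then show ?thesis by (rule finite_subset) auto
qed

lemma bound_le: "candidate x l m \<Longrightarrow> bound x \<le> candidate_bound x l m"
  unfolding bound_def using finite_candidates by (intro Min_le) auto

lemma candidate_one: "1 \<le> x \<Longrightarrow> x \<le> n \<Longrightarrow> candidate x (x - 1) 1"
  by (auto simp: candidate_def)

lemma bound_attained:
  assumes "1 \<le> x" "x \<le> n"
  obtains l m where "candidate x l m" "bound x = candidate_bound x l m"
proof -
  have "bound x \<in> {candidate_bound x l m | l m. candidate x l m}"
    unfolding bound_def using finite_candidates candidate_one[OF assms] by (intro Min_in) auto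
  then show ?thesis using that by auto
qed

lemma candidate_cp_bound:
  assumes "candidate x l m"
  shows "0 < cp_bound \<beta> m (x - l)" "cp_bound \<beta> m (x - l) < 1"
    "binomial_tail m (cp_bound \<beta> m (x - l)) (x - l) = 1 - \<beta>"
  using cp_bound[of "x - l" m \<beta>] assms \<beta> by (auto simp: candidate_def)

text \<open>The candidate with \<open>x - 1\<close> sure successes and a single free trial already has an average below \<open>x / n\<close>.\<close>

lemma bound_less:
  assumes "1 \<le> x" "x \<le> n"
  shows "bound x < real x / real n"
proof -
  have "bound x \<le> candidate_bound x (x - 1) 1"
    by (rule bound_le[OF candidate_one[OF assms]])
  also have "\<dots> < (1 + real (x - 1)) / real n"
    using candidate_cp_bound(2)[OF candidate_one[OF assms]] n
    by (simp add: candidate_bound_def divide_strict_right_mono)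
  finally show ?thesis using assms by (simp add: of_nat_diff)
qed

lemma bound_pos:
  assumes "1 \<le> x" "x \<le> n"
  shows "0 < bound x"
proof -
  obtain l m where lm: "candidate x l m" "bound x = candidate_bound x l m"
    using bound_attained[OF assms] .
  have "0 < real m * cp_bound \<beta> m (x - l)"
    using candidate_cp_bound(1)[OF lm(1)] lm(1) by (auto simp: candidate_def)
  then show ?thesis using n lm by (simp add: candidate_bound_def add_pos_nonneg)
qed

text \<open>Given an optimal candidate for \<open>y\<close>, either \<open>y - x\<close> of its sure successes are turned into sure failures, or,
if there are not that many, all of them are, and the common probability can be lowered as well.\<close>

lemma bound_strict_mono:
  assumes "1 \<le> x" "x < y" "y \<le> n"
  shows "bound x < bound y"
proof -
  obtain l m where lm: "candidate y l m" "bound y = candidate_bound y l m"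
    using bound_attained[of y] assms by auto
  show ?thesis
  proof (cases "y - x \<le> l")
    case True
    let ?l = "l - (y - x)"
    have eq: "x - ?l = y - l" using True assms by linarith
    have "candidate x ?l m" using lm(1) True assms by (auto simp: candidate_def)
    then have "bound x \<le> candidate_bound x ?l m" by (rule bound_le)
    also have "\<dots> < candidate_bound y l m"
      unfolding candidate_bound_def eq using True assms n by (intro divide_strict_right_mono) auto
    finally show ?thesis using lm by simp
  next
    case False
    have m: "y - l \<le> m" "m \<le> n" "x < y - l" using lm(1) False by (auto simp: candidate_def)
    then have "candidate x 0 m" using assms by (auto simp: candidate_def)
    then have "bound x \<le> candidate_bound x 0 m" by (rule bound_le)
    also have "cp_bound \<beta> m x < cp_bound \<beta> m (y - l)"
      using m assms \<beta> by (intro cp_bound_strict_mono) auto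
    then have "candidate_bound x 0 m < candidate_bound y l m"
      unfolding candidate_bound_def using n m assms
      by (intro divide_strict_right_mono add_less_le_mono) auto
    finally show ?thesis using lm by simp
  qed
qed

lemma mem_K_iff:
  assumes "x \<le> n"
  shows "t \<in> K x \<longleftrightarrow> (\<exists>l m b. l \<le> x \<and> x - l \<le> m \<and> m \<le> n - l \<and> b \<in> cp_upray \<beta> m (x - l)
    \<and> t = (real m * b + real l) / real n)"
proof -
  have "t \<in> K x \<longleftrightarrow> (\<exists>l\<in>{0..x}. \<exists>m\<in>{x - l..n - l}. \<exists>b\<in>cp_upray \<beta> m (x - l).
      t = real m / real n * b + real l / real n)"
    using assms by (simp add: K_eq image_iff)
  moreover have "real m / real n * b + real l / real n = (real m * b + real l) / real n" for l m b
    by (simp add: add_divide_distrib)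
  ultimately show ?thesis
    unfolding Bex_def atLeastAtMost_iff by simp
qed

lemma cp_upray_subset: "x \<le> m \<Longrightarrow> cp_upray \<beta> m x \<subseteq> {0..1}"
  using cp_bound_in(1)[of x m \<beta>] \<beta> by (cases "x = 0") (auto simp: cp_upray_def)

lemma K_at_0: "K 0 = {0..1}"
proof (intro set_eqI iffI)
  fix t assume "t \<in> K 0"
  then obtain m b where b: "m \<le> n" "b \<in> {0..1}" and t: "t = real m * b / real n"
    by (auto simp: mem_K_iff cp_upray_def)
  have "real m * b \<le> real n * 1" using b by (intro mult_mono) auto
  then show "t \<in> {0..1}" using n b by (simp add: t)
next
  fix t :: real assume "t \<in> {0..1}"
  then have "t \<in> cp_upray \<beta> n (0 - 0)" "t = (real n * t + real 0) / real n"
    using n by (simp_all add: cp_upray_def)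
  then show "t \<in> K 0" unfolding mem_K_iff[OF le0]
    by - (rule exI[of _ "0 :: nat"], rule exI[of _ n], rule exI[of _ t], simp)
qed

lemma K_eq_greaterThan:
  assumes "1 \<le> x" "x \<le> n"
  shows "K x = {bound x<..1}"
proof (intro set_eqI iffI)
  fix t assume "t \<in> K x"
  then obtain l m b where b: "l \<le> x" "x - l \<le> m" "m \<le> n - l" "b \<in> cp_upray \<beta> m (x - l)"
    and t: "t = (real m * b + real l) / real n"
    using assms by (auto simp: mem_K_iff)
  have b01: "b \<in> {0..1}"
    using b(2,4) cp_upray_subset by blast
  have "real m * b \<le> real m" using b01 by (simp add: mult_left_le)
  moreover have "real m + real l \<le> real n" using b assms by linarith
  ultimately have "t \<le> 1" using n by (simp add: t)
  moreover have "bound x < t"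
  proof (cases "l = x")
    case True
    have "bound x < real x / real n" by (rule bound_less[OF assms])
    also have "\<dots> \<le> t" unfolding t True using b01 by (intro divide_right_mono) auto
    finally show ?thesis .
  next
    case False
    then have lm: "candidate x l m" using b by (auto simp: candidate_def)
    then have "bound x \<le> candidate_bound x l m" by (rule bound_le)
    also have "0 < m" "cp_bound \<beta> m (x - l) < b"
      using b False lm by (auto simp: cp_upray_def candidate_def)
    then have "candidate_bound x l m < t"
      unfolding candidate_bound_def t using n by (intro divide_strict_right_mono) auto
    finally show ?thesis .
  qed
  ultimately show "t \<in> {bound x<..1}" by simp
next
  fix t assume t: "t \<in> {bound x<..1}"
  obtain l m where lm: "candidate x l m" "bound x = candidate_bound x l m"
    using bound_attained[OF assms] .
  have m: "0 < m" using lm(1) by (auto simp: candidate_def)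
  show "t \<in> K x"
  \<comment> \<open>Averages up to \<open>(m + l) / n\<close> come from the optimal candidate, larger ones from \<open>x\<close> sure successes.\<close>
  proof (cases "t \<le> real (m + l) / real n")
    case True
    define b where "b = (real n * t - real l) / real m"
    have "cp_bound \<beta> m (x - l) < b"
      using t lm(2) n m by (auto simp: candidate_bound_def b_def field_simps)
    moreover have "b \<le> 1" using True n m by (auto simp: b_def field_simps)
    ultimately have "b \<in> cp_upray \<beta> m (x - l)" using lm(1) by (auto simp: cp_upray_def candidate_def)
    moreover have "t = (real m * b + real l) / real n" using n m by (simp add: b_def)
    ultimately show ?thesis
      using lm(1) unfolding mem_K_iff[OF assms(2)]
      by - (rule exI[of _ l], rule exI[of _ m], rule exI[of _ b], simp add: candidate_def)
  next
    case False
    moreover have "x \<le> m + l" using lm(1) by (auto simp: candidate_def)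
    then have "real x / real n \<le> real (m + l) / real n" by (intro divide_right_mono) auto
    ultimately have xt: "real x < real n * t" using n by (auto simp: field_simps)
    also have "\<dots> \<le> real n" using t n by simp
    finally have xn: "x < n" by simp
    define b where "b = (real n * t - real x) / real (n - x)"
    have "0 \<le> b" "b \<le> 1" using t n xt xn by (auto simp: b_def field_simps of_nat_diff)
    then have "b \<in> cp_upray \<beta> (n - x) (x - x)" by (simp add: cp_upray_def)
    moreover have "t = (real (n - x) * b + real x) / real n" using n xn by (simp add: b_def)
    ultimately show ?thesis
      using assms(2) unfolding mem_K_iff[OF assms(2)]
      by - (rule exI[of _ x], rule exI[of _ "n - x"], rule exI[of _ b], simp add: of_nat_diff)
  qed
qed


lemma bound_in_unit: "1 \<le> x \<Longrightarrow> x \<le> n \<Longrightarrow> 0 < bound x \<and> bound x < 1"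
proof -
  assume x: "1 \<le> x" "x \<le> n"
  have "real x / real n \<le> 1" using x by simp
  then show ?thesis using bound_pos[OF x] bound_less[OF x] by linarith
qed

lemma K_strict:
  assumes "x < y" "y \<le> n"
  shows "K y \<subset> K x"
proof (cases "x = 0")
  case True
  have "0 \<in> K x - K y" using True assms bound_in_unit[of y] K_eq_greaterThan[of y] by (auto simp: K_at_0)
  moreover have "K y \<subseteq> K x" using True assms bound_in_unit[of y] K_eq_greaterThan[of y] by (auto simp: K_at_0)
  ultimately show ?thesis by blast
next
  case False
  have "bound x < bound y" using False assms by (intro bound_strict_mono) auto
  then have "bound y \<in> K x - K y" "K y \<subseteq> K x"
    using False assms bound_in_unit[of y] by (auto simp: K_eq_greaterThan)
  then show ?thesis by blast
qed

lemma K_subset: "x \<le> n \<Longrightarrow> K x \<subseteq> {0..1}"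
  using K_at_0 K_strict[of 0 x] by (cases "x = 0") auto

lemma avg_unit:
  assumes "p \<in> unit_cube n"
  shows "avg n p \<in> {0..1}" "(\<Sum>j\<in>{1..n}. p j) = real n * avg n p"
proof -
  have p: "p i \<in> {0..1}" if "i \<in> {1..n}" for i
    using assms that by (auto simp: unit_cube_def)
  then have "0 \<le> (\<Sum>j\<in>{1..n}. p j)" by (intro sum_nonneg) auto
  moreover have "(\<Sum>j\<in>{1..n}. p j) \<le> (\<Sum>j\<in>{1..n}. 1)" using p by (intro sum_mono) auto
  ultimately show "avg n p \<in> {0..1}" using n by (simp add: avg_def divide_le_eq)
  show "(\<Sum>j\<in>{1..n}. p j) = real n * avg n p" using n by (simp add: avg_def)
qed

text \<open>Hoeffding's theorem reduces the claim to a three-valued vector with the same average. That average is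
below \<open>x / n\<close>, so the vector has fewer than \<open>x\<close> ones and is either a candidate, for which the bound on the
average bounds the common probability by the Clopper-Pearson bound, or cannot reach \<open>x\<close> successes.\<close>

lemma tail_le_if_avg_le_bound:
  assumes p: "p \<in> unit_cube n" and x: "1 \<le> x" "x \<le> n" and le: "avg n p \<le> bound x"
  shows "tail {1..n} p x \<le> 1 - \<beta>"
proof -
  have p01: "p i \<in> {0..1}" if "i \<in> {1..n}" for i
    using p that by (auto simp: unit_cube_def)
  obtain l m z a where lmz: "l + m + z = card {1..n}" and a: "a \<in> {0..1}"
    and sum: "sum p {1..n} = real l + real m * a"
    and t: "tail {1..n} p x \<le> binomial_tail m a (x - l)"
    by (rule hoeffding_extremal[where A = "{1..n}" and p = p and x = x]) (use p01 in auto)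
  have nt: "real n * avg n p = real m * a + real l" using avg_unit(2)[OF p] sum by simp
  have "real n * avg n p \<le> real n * bound x" using le n by simp
  also have "\<dots> < real x" using bound_less[OF x] n by (simp add: field_simps)
  finally have "real m * a + real l < real x" using nt by simp
  moreover have "real m * a \<ge> 0" using a by simp
  ultimately have lx: "l < x" by linarith
  show ?thesis
  proof (cases "m < x - l")
    case True
    then show ?thesis using t a \<beta> by (simp add: binomial_tail_beyond)
  next
    case False
    then have lm: "candidate x l m" using lx lmz by (auto simp: candidate_def)
    have "real n * avg n p \<le> real n * candidate_bound x l m"
      using le bound_le[OF lm] n by simp
    then have "real m * a \<le> real m * cp_bound \<beta> m (x - l)"
      using n nt by (simp add: candidate_bound_def)
    then have "a \<le> cp_bound \<beta> m (x - l)" using False lx by (simp add: mult_le_cancel_left)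
    then have "binomial_tail m a (x - l) \<le> 1 - \<beta>"
      using binomial_tail_le_iff_cp_bound[of "x - l" m \<beta> a] False lx a \<beta> by simp
    then show ?thesis using t by simp
  qed
qed

text \<open>As \<open>K\<close> is decreasing, an average is covered until the first \<open>x\<close> with \<open>K x\<close> missing it, and from there on the
tail is at most \<open>1 - \<beta>\<close>.\<close>

lemma coverage_K_ge:
  assumes p: "p \<in> unit_cube n"
  shows "\<beta> \<le> coverage n K p"
proof (cases "\<forall>y\<le>n. avg n p \<in> K y")
  case True
  then have "1 - tail {1..n} p (Suc n) \<le> coverage n K p" by (intro coverage_ge) auto
  moreover have "tail {1..n} p (Suc n) = 0" by (rule tail_beyond) auto
  ultimately show ?thesis using \<beta> by simp
next
  case False
  define x where "x = (LEAST y. y \<le> n \<and> avg n p \<notin> K y)"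
  have "\<exists>y. y \<le> n \<and> avg n p \<notin> K y" using False by auto
  then have x: "x \<le> n" "avg n p \<notin> K x" unfolding x_def by (metis (mono_tags, lifting) LeastI_ex)+
  have least: "avg n p \<in> K y" if "y < x" "y \<le> n" for y
    using not_less_Least[of y "\<lambda>y. y \<le> n \<and> avg n p \<notin> K y"] that by (auto simp: x_def)
  have x1: "1 \<le> x" using x avg_unit(1)[OF p] K_at_0 by (cases "x = 0") auto
  have "avg n p \<le> bound x" using x x1 K_eq_greaterThan[of x] avg_unit(1)[OF p] by auto
  then have "tail {1..n} p x \<le> 1 - \<beta>" by (rule tail_le_if_avg_le_bound[OF p x1 x(1)])
  then show ?thesis using coverage_ge[of x n p K, OF least] by simp
qed

lemma confidence_upray_K: "confidence_upray \<beta> n K"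
proof -
  have "upray_set (K x)" if "x \<le> n" for x
    using that K_at_0 K_eq_greaterThan[of x] bound_in_unit[of x] by (cases "x = 0") (auto simp: upray_set_def)
  then show ?thesis
    using coverage_K_ge K_subset by (auto simp: confidence_upray_def upray_def confidence_region_def)
qed

text \<open>Each point of the union defining \<open>K x\<close> is the average of such a three-valued vector, with \<open>l\<close> ones.\<close>

lemma exists_large_tail:
  assumes "x \<le> n" "t \<in> K x"
  obtains p where "p \<in> unit_cube n" "avg n p = t" "1 - \<beta> < tail {1..n} p x"
proof -
  obtain l m b where b: "l \<le> x" "x - l \<le> m" "m \<le> n - l" "b \<in> cp_upray \<beta> m (x - l)"
    and t: "t = (real m * b + real l) / real n"
    using assms by (auto simp: mem_K_iff)
  have b01: "b \<in> {0..1}" using b(2,4) cp_upray_subset by blast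
  have lm: "l + m \<le> n" using b assms by linarith
  have "1 - \<beta> < binomial_tail m b (x - l)"
  proof (cases "l = x")
    case True
    then show ?thesis using \<beta> by simp
  next
    case False
    then have "cp_bound \<beta> m (x - l) < b" using b by (auto simp: cp_upray_def)
    moreover have "1 \<le> x - l" using False b by linarith
    ultimately show ?thesis
      using binomial_tail_le_iff_cp_bound[of "x - l" m \<beta> b] b b01 \<beta> by auto
  qed
  then show ?thesis
    using that[of "three_valued n l m b"] three_valued[OF lm b01] t by (simp add: avg_def)
qed

text \<open>Otherwise the vector of the preceding lemma would be covered with probability less than \<open>\<beta>\<close>.\<close>

lemma confidence_region_meets:
  assumes "confidence_region \<beta> n K'" "x \<le> n" "t \<in> K x"
  obtains y where "x \<le> y" "y \<le> n" "t \<in> K' y"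
proof -
  obtain p where p: "p \<in> unit_cube n" "avg n p = t" "1 - \<beta> < tail {1..n} p x"
    using exists_large_tail[OF assms(2,3)] .
  have "\<beta> \<le> coverage n K' p" using assms(1) p(1) by (auto simp: confidence_region_def)
  then have "\<not> (\<forall>y. x \<le> y \<longrightarrow> y \<le> n \<longrightarrow> t \<notin> K' y)"
    using coverage_le[of x n p K'] p by auto
  then show ?thesis using that by auto
qed

lemma optimal_isotone_K: "optimal_isotone \<beta> n K"
  unfolding optimal_isotone_def
proof (intro conjI allI impI ballI subsetI)
  show "confidence_upray \<beta> n K" by (rule confidence_upray_K)
  show "isotone n K"
    unfolding isotone_def by (intro ballI impI psubset_imp_subset K_strict) auto
  fix K' x t
  assume K': "confidence_upray \<beta> n K' \<and> isotone n K'" and x: "x \<in> {0..n}" and t: "t \<in> K x"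
  obtain y where y: "x \<le> y" "y \<le> n" "t \<in> K' y"
    by (rule confidence_region_meets[of K' x t]) (use K' x t in \<open>auto simp: confidence_upray_def\<close>)
  moreover have "K' y \<subseteq> K' x" using K' x y by (cases "x = y") (auto simp: isotone_def)
  ultimately show "t \<in> K' x" by blast
qed

lemma admissible_K: "admissible \<beta> n K"
  unfolding admissible_def
proof (intro conjI allI impI ballI)
  show "confidence_upray \<beta> n K" by (rule confidence_upray_K)
  fix K' x
  assume K': "confidence_upray \<beta> n K' \<and> (\<forall>x\<in>{0..n}. K' x \<subseteq> K x)" and x: "x \<in> {0..n}"
  have "t \<in> K' x" if t: "t \<in> K x" for t
  proof -
    \<comment> \<open>Averages up to the bound at the next value are missed by \<open>K y\<close>, hence by \<open>K' y\<close>, for all \<open>y > x\<close>.\<close>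
    define s where "s = (if x = n then t else min t (bound (Suc x)))"
    have "bound (Suc x) \<in> K x" if "x \<noteq> n"
      using that x K_eq_greaterThan[of x] K_at_0 bound_in_unit[of "Suc x"] bound_strict_mono[of x "Suc x"]
      by (cases "x = 0") auto
    then have s: "s \<in> K x" "s \<le> t" using t by (auto simp: s_def min_def)
    obtain y where y: "x \<le> y" "y \<le> n" "s \<in> K' y"
      by (rule confidence_region_meets[of K' x s]) (use K' x s in \<open>auto simp: confidence_upray_def\<close>)
    have "y = x"
    proof (rule ccontr)
      assume "y \<noteq> x"
      then have xy: "Suc x \<le> y" "x \<noteq> n" using y by auto
      have "s \<in> K y" using K' y by auto
      then have "bound y < s" using K_eq_greaterThan[of y] xy y by auto
      moreover have "bound (Suc x) \<le> bound y"
        using bound_strict_mono[of "Suc x" y] xy y by (cases "Suc x = y") auto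
      ultimately show False using xy by (simp add: s_def)
    qed
    then have "s \<in> K' x" "upray_set (K' x)" "t \<in> {0..1}"
      using y K' x t K_subset[of x] by (auto simp: confidence_upray_def upray_def)
    then show "t \<in> K' x" using s by (auto simp: upray_set_def)
  qed
  then show "K' x = K x" using K' x by auto
qed

text \<open>The bound \<open>g\<close> for one success among \<open>m\<close> trials satisfies \<open>(1 - g) ^ m = \<beta>\<close>, and Bernoulli's inequality
gives \<open>\<beta> \<ge> 1 - m * g\<close>; so no candidate beats the single trial with success probability \<open>1 - \<beta>\<close>.\<close>

lemma bound_1: "bound 1 = (1 - \<beta>) / real n"
proof (rule antisym)
  have c: "cp_bound \<beta> m 1 \<in> {0..1}" "(1 - cp_bound \<beta> m 1) ^ m = \<beta>" if "1 \<le> m" for m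
    using cp_bound[of 1 m \<beta>] that \<beta> binomial_tail_1[of "cp_bound \<beta> m 1" m] by auto
  have "bound 1 \<le> candidate_bound 1 0 1" using n by (intro bound_le) (auto simp: candidate_def)
  also have "\<dots> = (1 - \<beta>) / real n" using c(2)[of 1] by (simp add: candidate_bound_def)
  finally show "bound 1 \<le> (1 - \<beta>) / real n" .
  obtain l m where lm: "candidate 1 l m" "bound 1 = candidate_bound 1 l m"
    using bound_attained[of 1] n by auto
  then have m: "l = 0" "1 \<le> m" by (auto simp: candidate_def)
  have "1 + real m * (- cp_bound \<beta> m 1) \<le> (1 + (- cp_bound \<beta> m 1)) ^ m"
    using c(1)[OF m(2)] by (intro Bernoulli_inequality) auto
  then have "1 - \<beta> \<le> real m * cp_bound \<beta> m 1" using c(2)[OF m(2)] by simp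
  then show "(1 - \<beta>) / real n \<le> bound 1"
    using lm(2) m(1) n by (simp add: candidate_bound_def divide_right_mono)
qed

text \<open>The infimum is attained by the vector with a single non-zero coordinate \<open>1 - \<beta>\<close>: its average is the excluded end
point of \<open>K 1\<close>, so it is covered only if no success occurs.\<close>

lemma effective_level_K: "effective_level n K = \<beta>"
proof -
  define p where "p = three_valued n 0 1 (1 - \<beta>)"
  have p: "p \<in> unit_cube n" "avg n p = (1 - \<beta>) / real n" "tail {1..n} p 1 = 1 - \<beta>"
    using three_valued[of 0 1 n "1 - \<beta>"] n \<beta> binomial_tail_1[of "1 - \<beta>" 1] by (auto simp: p_def avg_def)
  have "avg n p \<notin> K y" if "1 \<le> y" "y \<le> n" for y
    using that p(2) K_eq_greaterThan[of y] bound_1 bound_strict_mono[of 1 y] by (cases "y = 1") auto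
  then have "coverage n K p \<le> \<beta>" using coverage_le[of 1 n p K] p(3) by simp
  moreover have "bdd_below (coverage n K ` unit_cube n)"
    using coverage_K_ge by (intro bdd_belowI[of _ \<beta>]) auto
  ultimately have "effective_level n K \<le> \<beta>"
    unfolding effective_level_def using p(1) cINF_lower order_trans by fast
  moreover have "\<beta> \<le> effective_level n K"
    unfolding effective_level_def using p(1) coverage_K_ge by (intro cINF_greatest) auto
  ultimately show ?thesis by simp
qed


text \<open>Only optimality of the binomial candidate needs an argument, namely that the binomial law with average \<open>bound x\<close>
has tail at least \<open>1 - \<beta>\<close> at \<open>x\<close>. If \<open>bound x\<close> is at least \<open>(x - 1) / n\<close>, this holds already at \<open>(x - 1) / n\<close> by the
assumption on \<open>\<beta>\<close>; otherwise the sharp form of Hoeffding's theorem compares that binomial law with the optimal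
candidate, whose tail is \<open>1 - \<beta>\<close>.\<close>

lemma bound_eq_cp_bound:
  assumes \<beta>n: "measure_pmf.prob (binomial_pmf n (1 / real n)) {0, 1} \<le> \<beta>"
    and x: "2 \<le> x" "x \<le> n"
  shows "bound x = cp_bound \<beta> n x"
proof (rule antisym)
  have "bound x \<le> candidate_bound x 0 n" using x by (intro bound_le) (auto simp: candidate_def)
  then show "bound x \<le> cp_bound \<beta> n x" using n by (simp add: candidate_bound_def)
next
  have le: "cp_bound \<beta> n x \<le> t" if "t \<in> {0..1}" "1 - \<beta> \<le> binomial_tail n t x" for t
    using cp_bound[of x n \<beta>] binomial_tail_strict_mono[of t "cp_bound \<beta> n x" x n] that x \<beta>
    by (cases "cp_bound \<beta> n x \<le> t") auto
  obtain l m where lm: "candidate x l m" "bound x = candidate_bound x l m"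
    using bound_attained[of x] x by auto
  let ?g = "cp_bound \<beta> m (x - l)"
  have g: "?g \<in> {0..1}" "binomial_tail m ?g (x - l) = 1 - \<beta>"
    using candidate_cp_bound[OF lm(1)] by auto
  have lmn: "l + m \<le> n" using lm(1) x by (auto simp: candidate_def)
  have t01: "bound x \<in> {0..1}" using bound_in_unit[of x] x by auto
  have sum: "real l + real m * ?g = real n * bound x"
    using lm(2) n by (simp add: candidate_bound_def)
  show "cp_bound \<beta> n x \<le> bound x"
  proof (cases "real (x - 1) / real n \<le> bound x")
    case True
    have "{0, 1} = {..<2::nat}" by auto
    then have "1 - \<beta> \<le> binomial_tail n (1 / real n) 2"
      using \<beta>n prob_binomial_below[of n "1 / real n" 2] by simp
    also have "\<dots> \<le> binomial_tail n (real (x - 1) / real n) (x - 1 + 1)"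
      using x by (intro binomial_tail_above_mean) auto
    finally have "cp_bound \<beta> n x \<le> real (x - 1) / real n"
      using x by (intro le) auto
    then show ?thesis using True by simp
  next
    case False
    then have "real n * bound x \<le> real x - 1" using n x by (simp add: field_simps of_nat_diff)
    then have "tail {1..n} (three_valued n l m ?g) x \<le> binomial_tail n (bound x) x"
      using tail_le_binomial_tail[of "{1..n}" "three_valued n l m ?g" x] three_valued[OF lmn g(1)] sum n
      by (auto simp: unit_cube_def PiE_def Pi_def)
    then show ?thesis
      using le[OF t01] three_valued(3)[OF lmn g(1)] g(2) by simp
  qed
qed

end

theorem theorem1p2:
  fixes n :: nat and \<beta> :: real and K :: "nat \<Rightarrow> real set"
  assumes "n \<ge> 1" and "0 < \<beta>" and "\<beta> < 1"
    and K_eq: "\<And>x. x \<in> {0..n} \<Longrightarrow>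
      K x = (\<Union>l\<in>{0..x}. \<Union>m\<in>{x - l..n - l}.
               (\<lambda>a. real m / real n * a + real l / real n) ` cp_upray \<beta> m (x - l))"
  shows "optimal_isotone \<beta> n K
    \<and> admissible \<beta> n K
    \<and> strictly_isotone n K
    \<and> effective_level n K = \<beta>
    \<and> K 0 = {0..1}
    \<and> K 1 = {(1 - \<beta>) / real n<..1}
    \<and> (\<beta> \<ge> measure_pmf.prob (binomial_pmf n (1 / real n)) {0, 1} \<longrightarrow>
        (\<forall>x\<in>{2..n}. K x = {cp_bound \<beta> n x<..1}))"
proof -
  interpret average_success n \<beta> K
    using assms by unfold_locales
  have "strictly_isotone n K"
    using K_strict by (simp add: strictly_isotone_def)
  moreover have "K 1 = {(1 - \<beta>) / real n<..1}"
    using K_eq_greaterThan[of 1] bound_1 n by simp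
  moreover have "\<forall>x\<in>{2..n}. K x = {cp_bound \<beta> n x<..1}"
    if "measure_pmf.prob (binomial_pmf n (1 / real n)) {0, 1} \<le> \<beta>"
    using K_eq_greaterThan bound_eq_cp_bound[OF that] by simp
  ultimately show ?thesis
    using optimal_isotone_K admissible_K effective_level_K K_at_0 by blast
qed

end
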